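(* Let $G$ be a simple connected undirected $r$-regular graph with $n$ vertices and $m$ edges. For a fixed $l\in\mathbb N$, let $\mathcal P_l$ be the family of all integer partitions of $l$ into parts $p_1,p_2,\dots,p_s$, each of size at least $3$. For $P=\{p_1,p_2,\dots,p_s\}\in\mathcal P_l$, let $C_P$ be the disjoint union of cycles with $p_1,p_2,\dots,p_s$ vertices, respectively. Then the graphs $G\circledcirc C_P$, $P\in\mathcal P_l$, form a family of $D$-equienergetic graphs; that is, they all have the same number of vertices and the same distance energy.
   Context: For a connected graph $X$, the distance matrix $D(X)$ is the symmetric matrix of shortest-path distances between vertices; its eigenvalues are the distance eigenvalues of $X$, and the distance energy $E_D(X)$ is the sum of their absolute values (with multiplicity). Two graphs with the same number of vertices are $D$-equienergetic if they have the same distance energy. The subdivision graph $S(X)$ of a graph $X$ is obtained by subdividing each edge of $X$ exactly once, i.e. inserting one new vertex on each edge; its vertices are those of $V(X)$ together with one vertex for each edge of $X$. For vertex-disjoint graphs $G_1,G_2$, the subdivision vertex-vertex join $G_1\circledcirc G_2$ is obtained from $S(G_1)$ and $S(G_2)$ by joining every vertex in $V(G_1)$ to every vertex in $V(G_2)$. *)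

theory Defs
  imports "Graph_Theory.Graph_Theory" "Jordan_Normal_Form.Char_Poly" "HOL-Library.Multiset"
begin

text \<open>
  A finite simple undirected graph is a \<open>pair_graph\<close>: a finite symmetric loop-free digraph,
  each undirected edge being represented by its two opposite arcs.
\<close>

definition graph_edges :: "'a pair_pre_digraph \<Rightarrow> 'a set set" where
  "graph_edges X = {{u, v} | u v. (u, v) \<in> parcs X}"

definition connected_graph :: "'a pair_pre_digraph \<Rightarrow> bool" where
  "connected_graph X \<longleftrightarrow> Digraph_Component.connected (with_proj X)"

definition regular_graph :: "nat \<Rightarrow> 'a pair_pre_digraph \<Rightarrow> bool" where
  "regular_graph r X \<longleftrightarrow> (\<forall>v \<in> pverts X. out_degree (with_proj X) v = r)"


subsection \<open>Distance matrix and distance energy\<close>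

text \<open>With unit arc weights, \<open>\<mu>\<close> is the least number of arcs of a walk; it is finite on connected graphs.\<close>

definition graph_dist :: "'a pair_pre_digraph \<Rightarrow> 'a \<Rightarrow> 'a \<Rightarrow> real" where
  "graph_dist X u v = real_of_ereal (wf_digraph.\<mu> (with_proj X) (\<lambda>_. 1) u v)"

definition dist_matrix :: "'a pair_pre_digraph \<Rightarrow> 'a list \<Rightarrow> real mat" where
  "dist_matrix X vs = mat (length vs) (length vs) (\<lambda>(i, j). graph_dist X (vs ! i) (vs ! j))"

text \<open>
  The vertices are listed in an arbitrary order; reordering them conjugates the matrix by a
  permutation matrix, so the spectrum does not depend on the choice. The matrix is real symmetric,
  so all roots of its characteristic polynomial are real and \<open>order\<close> counts each with its
  multiplicity as an eigenvalue.
\<close>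

definition vertex_list :: "'a pair_pre_digraph \<Rightarrow> 'a list" where
  "vertex_list X = (SOME vs. distinct vs \<and> set vs = pverts X)"

definition dist_energy :: "'a pair_pre_digraph \<Rightarrow> real" where
  "dist_energy X = (let D = dist_matrix X (vertex_list X) in
     \<Sum>x | eigenvalue D x. real (Polynomial.order x (char_poly D)) * \<bar>x\<bar>)"

text \<open>The distance energy is only meaningful for connected graphs, hence the connectedness clauses.\<close>

definition D_equienergetic :: "'a pair_pre_digraph \<Rightarrow> 'b pair_pre_digraph \<Rightarrow> bool" where
  "D_equienergetic X Y \<longleftrightarrow>
     connected_graph X \<and> connected_graph Y \<and>
     card (pverts X) = card (pverts Y) \<and> dist_energy X = dist_energy Y"


subsection \<open>Subdivision vertex-vertex join\<close>

text \<open>\<open>Inl v\<close> is an original vertex, \<open>Inr e\<close> the vertex inserted on the edge \<open>e\<close>.\<close>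

definition subdivision_graph :: "'a pair_pre_digraph \<Rightarrow> ('a + 'a set) pair_pre_digraph" where
  "subdivision_graph X =
     \<lparr> pverts = Inl ` pverts X \<union> Inr ` graph_edges X,
       parcs = {(Inl v, Inr e) | v e. e \<in> graph_edges X \<and> v \<in> e} \<union>
               {(Inr e, Inl v) | v e. e \<in> graph_edges X \<and> v \<in> e} \<rparr>"

text \<open>The outer sum type keeps the two subdivision graphs vertex-disjoint.\<close>

definition subdivision_vv_join ::
    "'a pair_pre_digraph \<Rightarrow> 'b pair_pre_digraph \<Rightarrow> (('a + 'a set) + ('b + 'b set)) pair_pre_digraph"
    (infixl \<open>\<circledcirc>\<close> 65) where
  "X \<circledcirc> Y =
     \<lparr> pverts = Inl ` pverts (subdivision_graph X) \<union> Inr ` pverts (subdivision_graph Y),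
       parcs = {(Inl a, Inl b) | a b. (a, b) \<in> parcs (subdivision_graph X)} \<union>
               {(Inr a, Inr b) | a b. (a, b) \<in> parcs (subdivision_graph Y)} \<union>
               {(Inl (Inl u), Inr (Inl v)) | u v. u \<in> pverts X \<and> v \<in> pverts Y} \<union>
               {(Inr (Inl v), Inl (Inl u)) | u v. u \<in> pverts X \<and> v \<in> pverts Y} \<rparr>"


subsection \<open>Partitions and disjoint unions of cycles\<close>

definition cycle_graph :: "nat \<Rightarrow> nat pair_pre_digraph" where
  "cycle_graph p =
     \<lparr> pverts = {..<p},
       parcs = {(i, j). i < p \<and> j < p \<and> (j = Suc i mod p \<or> i = Suc j mod p)} \<rparr>"

definition disjoint_union_graph ::
    "'i set \<Rightarrow> ('i \<Rightarrow> 'a pair_pre_digraph) \<Rightarrow> ('i \<times> 'a) pair_pre_digraph" where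
  "disjoint_union_graph I F =
     \<lparr> pverts = Sigma I (\<lambda>i. pverts (F i)),
       parcs = {((i, u), (i, v)) | i u v. i \<in> I \<and> (u, v) \<in> parcs (F i)} \<rparr>"

text \<open>Integer partitions are multisets of parts.\<close>

definition partitions_ge3 :: "nat \<Rightarrow> nat multiset set" where
  "partitions_ge3 l = {P. sum_mset P = l \<and> (\<forall>p \<in># P. 3 \<le> p)}"

text \<open>The index \<open>(p, k)\<close> stands for the \<open>k\<close>-th occurrence of the part \<open>p\<close> in \<open>P\<close>.\<close>

definition cycles_graph :: "nat multiset \<Rightarrow> ((nat \<times> nat) \<times> nat) pair_pre_digraph" where
  "cycles_graph P = disjoint_union_graph {(p, k). k < count P p} (\<lambda>(p, k). cycle_graph p)"

end

theory Submission
  imports Defs "Jordan_Normal_Form.Schur_Decomposition"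
begin

text \<open>
  Write \<open>H\<close> for \<open>C\<^sub>P\<close>. All original vertices of \<open>G\<close> are joined to all original vertices of \<open>H\<close>, so
  distances in the join are short and explicit. Give an original vertex depth 0 and an inserted
  vertex depth 1. Vertices of different graphs have distance \<open>1\<close> plus their depths, and vertices of the
  same graph have distance \<open>2\<close> plus their depths minus twice the number of original vertices
  that are ends of both (\<open>graph_dist_join\<close>, \<open>same_side_dist_eq_overlap\<close>). Hence the distance
  matrix has the form \<open>D = K - 2 N\<close>. Here \<open>K\<close> sees only \<open>G\<close>, the numbers of vertices and edges of \<open>H\<close> and
  the depths, and \<open>N\<close> counts common ends inside \<open>H\<close>. The matrix \<open>N\<close> is a Gram matrix, so it
  is positive semidefinite.

  Only \<open>N\<close> depends on the partition, and it can affect only the eigenvalues \<open>\<le> 0\<close> of \<open>D\<close>. The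
  reason is that \<open>H\<close> is regular: \<open>N\<close> acts on the columns of \<open>K\<close>, which are constant on each depth of
  \<open>H\<close>, in a way that does not depend on the partition, and \<open>-2 N\<close> is all that is left of \<open>D\<close> on the
  orthogonal complement of these columns. In terms of determinants,
  \<open>det (t - D) = det (t + 2 N) det (1 - E)\<close> for \<open>t > 0\<close>, where \<open>E\<close> is determined by \<open>K\<close> and the
  common product \<open>N K\<close>, and \<open>det (t + 2 N) \<noteq> 0\<close> (\<open>order_positive_root_perturbation\<close>).
  So the positive distance eigenvalues and their multiplicities are the same for all partitions.

  Finally \<open>D\<close> is symmetric with zero diagonal, so its eigenvalues are real and add up to zero, and
  the energy is twice the sum of the positive ones (\<open>spectral_energy_trace_0\<close>).
\<close>

section \<open>The spectrum of a real symmetric matrix\<close>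

text \<open>
  If \<open>A v = a v\<close> then \<open>v\<^sup>* A v = a \<parallel>v\<parallel>\<^sup>2\<close>, and conjugating the left-hand side only swaps the two
  summation indices of the quadratic form.
\<close>

lemma symmetric_real_eigenvalue_is_real:
  fixes A :: "real mat"
  assumes A: "A \<in> carrier_mat n n"
    and sym: "\<And>i j. i < n \<Longrightarrow> j < n \<Longrightarrow> A $$ (i, j) = A $$ (j, i)"
    and ev: "eigenvalue (map_mat complex_of_real A) a"
  shows "a \<in> \<real>"
proof -
  from ev A obtain v where v: "v \<in> carrier_vec n" "v \<noteq> 0\<^sub>v n"
    and eq: "map_mat complex_of_real A *\<^sub>v v = a \<cdot>\<^sub>v v"
    unfolding eigenvalue_def eigenvector_def by auto
  have row: "(\<Sum>j<n. complex_of_real (A $$ (i, j)) * v $ j) = a * v $ i" if "i < n" for i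
    using arg_cong[OF eq, of "\<lambda>w. w $ i"] that A v
    by (simp add: scalar_prod_def atLeast0LessThan)
  define q where "q = (\<Sum>i<n. \<Sum>j<n. complex_of_real (A $$ (i, j)) * v $ j * cnj (v $ i))"
  define s where "s = (\<Sum>i<n. (cmod (v $ i))\<^sup>2)"
  have "cnj q = (\<Sum>i<n. \<Sum>j<n. complex_of_real (A $$ (i, j)) * cnj (v $ j) * v $ i)"
    unfolding q_def by simp
  also have "\<dots> = (\<Sum>j<n. \<Sum>i<n. complex_of_real (A $$ (i, j)) * cnj (v $ j) * v $ i)"
    by (rule sum.swap)
  also have "\<dots> = q"
    unfolding q_def by (intro sum.cong refl) (use sym in \<open>auto simp: mult_ac\<close>)
  finally have q_real: "q \<in> \<real>"
    by (simp add: Reals_cnj_iff)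
  have "q = (\<Sum>i<n. (\<Sum>j<n. complex_of_real (A $$ (i, j)) * v $ j) * cnj (v $ i))"
    unfolding q_def by (simp add: sum_distrib_right)
  also have "\<dots> = (\<Sum>i<n. a * (v $ i * cnj (v $ i)))"
    by (intro sum.cong refl) (simp add: row)
  also have "\<dots> = a * complex_of_real s"
    unfolding s_def of_real_sum sum_distrib_left complex_norm_square ..
  finally have q: "q = a * complex_of_real s" .
  obtain i where i: "i < n" "v $ i \<noteq> 0"
    using v by (metis carrier_vecD eq_vecI index_zero_vec)
  have "(cmod (v $ i))\<^sup>2 \<le> s"
    unfolding s_def by (rule member_le_sum) (use i in auto)
  then have "s \<noteq> 0"
    using i by auto
  then have "a = q / complex_of_real s"
    using q by simp
  then show ?thesis
    using q_real by auto
qed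

text \<open>
  The characteristic polynomial has all its linear factors over \<open>\<complex>\<close>; the roots are real, so the
  factorization is the image of one over \<open>\<real>\<close>.
\<close>

lemma symmetric_real_char_poly_splits:
  fixes A :: "real mat"
  assumes A: "A \<in> carrier_mat n n"
    and sym: "\<And>i j. i < n \<Longrightarrow> j < n \<Longrightarrow> A $$ (i, j) = A $$ (j, i)"
  obtains es where "char_poly A = (\<Prod>e\<leftarrow>es. [:- e, 1:])"
proof -
  interpret of_real_poly: map_poly_inj_idom_hom complex_of_real ..
  let ?C = "map_mat complex_of_real A"
  have C: "?C \<in> carrier_mat n n"
    using A by simp
  obtain as where as: "char_poly ?C = (\<Prod>a\<leftarrow>as. [:- a, 1:])"
    using char_poly_factorized[OF C] by blast
  have real: "a \<in> \<real>" if "a \<in> set as" for a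
  proof -
    have "poly (char_poly ?C) a = 0"
      unfolding as poly_prod_list using that by force
    then show ?thesis
      using symmetric_real_eigenvalue_is_real[OF A sym] eigenvalue_root_char_poly[OF C] by blast
  qed
  have "map_poly complex_of_real (char_poly A) = (\<Prod>a\<leftarrow>as. [:- a, 1:])"
    using as of_real_hom.char_poly_hom[OF A] by metis
  also have "\<dots> = (\<Prod>a\<leftarrow>as. map_poly complex_of_real [:- Re a, 1:])"
    by (intro arg_cong[of _ _ prod_list] map_cong refl) (use real in \<open>auto simp: of_real_Re\<close>)
  also have "\<dots> = map_poly complex_of_real (\<Prod>e\<leftarrow>map Re as. [:- e, 1:])"
    by (induct as) (simp_all del: of_real_Re mult_pCons_left add: of_real_poly.hom_mult)
  finally show ?thesis
    by (intro that[of "map Re as"]) (simp only: of_real_poly.eq_iff)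
qed

lemma sum_diag_mult_commute:
  fixes A B :: "'a :: comm_semiring_0 mat"
  assumes "A \<in> carrier_mat n n" "B \<in> carrier_mat n n"
  shows "sum_list (diag_mat (A * B)) = sum_list (diag_mat (B * A))"
proof -
  have d: "sum_list (diag_mat (X * Y)) = (\<Sum>i<n. \<Sum>j<n. X $$ (i, j) * Y $$ (j, i))"
    if "X \<in> carrier_mat n n" "Y \<in> carrier_mat n n" for X Y :: "'a mat"
    using that by (simp add: diag_mat_def interv_sum_list_conv_sum_set_nat scalar_prod_def
        atLeast0LessThan)
  show ?thesis
    unfolding d[OF assms] d[OF assms(2,1)] by (subst sum.swap) (simp add: mult.commute)
qed

text \<open>
  Schur triangularization puts the roots on the diagonal of a matrix similar to \<open>A\<close>, and similar
  matrices have the same trace.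
\<close>

lemma sum_roots_char_poly_eq_trace:
  fixes A :: "real mat"
  assumes A: "A \<in> carrier_mat n n"
    and es: "char_poly A = (\<Prod>e\<leftarrow>es. [:- e, 1:])"
  shows "sum_list es = sum_list (diag_mat A)"
proof -
  obtain B P Q where "schur_decomposition A es = (B, P, Q)"
    by (cases "schur_decomposition A es") auto
  from schur_decomposition[OF A es this]
  have wit: "similar_mat_wit A B P Q" and diag: "diag_mat B = es" by auto
  note w = similar_mat_witD2[OF A wit]
  have "sum_list (diag_mat A) = sum_list (diag_mat (P * (B * Q)))"
    using w by (simp add: assoc_mult_mat[of _ n n _ n _ n])
  also have "\<dots> = sum_list (diag_mat (B * Q * P))"
    using w by (intro sum_diag_mult_commute[of _ n]) auto
  also have "B * Q * P = B"
    using w by (simp add: assoc_mult_mat[of _ n n _ n _ n])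
  finally show ?thesis
    by (simp add: diag)
qed

definition spectral_energy :: "real mat \<Rightarrow> real" where
  "spectral_energy A =
     (\<Sum>x | eigenvalue A x. real (Polynomial.order x (char_poly A)) * \<bar>x\<bar>)"

lemma order_prod_linear_factors:
  fixes x :: "'a :: idom"
  shows "Polynomial.order x (\<Prod>e\<leftarrow>es. [:- e, 1:]) = count_list es x"
proof (induct es)
  case Nil
  show ?case by (simp add: order_0I)
next
  case (Cons e es)
  have "(\<Prod>e\<leftarrow>es. [:- e, 1:]) \<noteq> 0"
    by auto
  then show ?case
    using Cons order_linear_power[of x "- e" 1] by (simp add: order_mult del: mult_pCons_left)
qed

lemma sum_list_weighted_by_count:
  fixes g :: "'a \<Rightarrow> real"
  assumes "finite S" "set es \<subseteq> S"
  shows "(\<Sum>x\<in>S. real (count_list es x) * g x) = (\<Sum>e\<leftarrow>es. g e)"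
  using assms(2)
proof (induct es)
  case (Cons e es)
  have "(\<Sum>x\<in>S. real (count_list (e # es) x) * g x)
      = (\<Sum>x\<in>S. (if e = x then g x else 0) + real (count_list es x) * g x)"
    by (intro sum.cong) (auto simp: algebra_simps)
  then show ?case
    using Cons assms(1) by (simp add: sum.distrib)
qed simp

text \<open>
  As the eigenvalues add up to zero, adding their sum to the sum of their absolute values changes
  nothing; since \<open>\<bar>x\<bar> + x\<close> is \<open>2 x\<close> or \<open>0\<close>, only the positive eigenvalues remain.
\<close>

lemma spectral_energy_trace_0:
  fixes A :: "real mat"
  assumes A: "A \<in> carrier_mat n n"
    and sym: "\<And>i j. i < n \<Longrightarrow> j < n \<Longrightarrow> A $$ (i, j) = A $$ (j, i)"
    and diag: "\<And>i. i < n \<Longrightarrow> A $$ (i, i) = 0"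
  shows "spectral_energy A =
    2 * (\<Sum>x | 0 < x \<and> Polynomial.order x (char_poly A) \<noteq> 0.
          real (Polynomial.order x (char_poly A)) * x)"
proof -
  obtain es where es: "char_poly A = (\<Prod>e\<leftarrow>es. [:- e, 1:])"
    using symmetric_real_char_poly_splits[OF A sym] by blast
  have ord: "Polynomial.order x (char_poly A) = count_list es x" for x
    unfolding es by (rule order_prod_linear_factors)
  have ev: "eigenvalue A x \<longleftrightarrow> x \<in> set es" for x
    unfolding eigenvalue_root_char_poly[OF A] es poly_prod_list
    by auto
  have weighted: "(\<Sum>x\<in>set es. real (count_list es x) * g x) = (\<Sum>e\<leftarrow>es. g e)" for g
    using sum_list_weighted_by_count[of "set es" es g] by simp
  have "sum_list es = 0"
    using sum_roots_char_poly_eq_trace[OF A es] diag A by (simp add: diag_mat_def comp_def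
        interv_sum_list_conv_sum_set_nat)
  then have "(\<Sum>x\<in>set es. real (count_list es x) * x) = 0"
    using weighted[of "\<lambda>x. x"] by simp
  then have "spectral_energy A = (\<Sum>x\<in>set es. real (count_list es x) * \<bar>x\<bar>)
      + (\<Sum>x\<in>set es. real (count_list es x) * x)"
    by (simp add: spectral_energy_def ev ord)
  also have "\<dots> = (\<Sum>x\<in>set es. real (count_list es x) * (\<bar>x\<bar> + x))"
    by (simp add: sum.distrib ring_distribs)
  also have "\<dots> = (\<Sum>x | x \<in> set es \<and> 0 < x. real (count_list es x) * (\<bar>x\<bar> + x))"
    by (rule sum.mono_neutral_right) auto
  also have "{x. x \<in> set es \<and> 0 < x} = {x. 0 < x \<and> count_list es x \<noteq> 0}"
    by (auto simp: count_list_0_iff)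
  also have "(\<Sum>x\<in>\<dots>. real (count_list es x) * (\<bar>x\<bar> + x))
      = 2 * (\<Sum>x\<in>{x. 0 < x \<and> count_list es x \<noteq> 0}. real (count_list es x) * x)"
    unfolding sum_distrib_left by (intro sum.cong refl) auto
  finally show ?thesis
    by (simp add: ord)
qed

section \<open>Positive eigenvalues under positive semidefinite perturbations\<close>

definition psd_mat :: "nat \<Rightarrow> real mat \<Rightarrow> bool" where
  "psd_mat n N \<longleftrightarrow> N \<in> carrier_mat n n \<and> (\<forall>v \<in> carrier_vec n. 0 \<le> v \<bullet> (N *\<^sub>v v))"

lemma det_shifted_psd_neq_0:
  assumes N: "psd_mat n N" and t: "0 < t"
  shows "det (t \<cdot>\<^sub>m 1\<^sub>m n + 2 \<cdot>\<^sub>m N) \<noteq> 0"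
proof
  have Nc: "N \<in> carrier_mat n n"
    using N by (simp add: psd_mat_def)
  let ?S = "t \<cdot>\<^sub>m 1\<^sub>m n + 2 \<cdot>\<^sub>m N"
  assume "det ?S = 0"
  then obtain v where v: "v \<in> carrier_vec n" "v \<noteq> 0\<^sub>v n" and Sv: "?S *\<^sub>v v = 0\<^sub>v n"
    using det_0_iff_vec_prod_zero_field[of ?S n] Nc by auto
  have "?S *\<^sub>v v = t \<cdot>\<^sub>v v + 2 \<cdot>\<^sub>v (N *\<^sub>v v)"
    using Nc v by (intro eq_vecI) (auto simp: add_mult_distrib_mat_vec[of _ n n])
  then have "v \<bullet> (t \<cdot>\<^sub>v v + 2 \<cdot>\<^sub>v (N *\<^sub>v v)) = 0"
    using Sv v by (metis scalar_prod_right_zero)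
  then have "t * (v \<bullet> v) + 2 * (v \<bullet> (N *\<^sub>v v)) = 0"
    using v Nc by (simp add: scalar_prod_add_distrib[of _ n])
  moreover have "0 \<le> v \<bullet> (N *\<^sub>v v)"
    using N v by (auto simp: psd_mat_def)
  moreover have "0 < v \<bullet> v"
    using conjugate_square_greater_0_vec[OF v(1)] v(2) by (simp add: conjugate_vec_def)
  ultimately show False
    using t by (metis add_pos_nonneg less_irrefl mult_nonneg_nonneg mult_pos_pos zero_le_numeral)
qed

lemma poly_char_poly:
  fixes A :: "'a :: field mat"
  assumes "A \<in> carrier_mat n n"
  shows "poly (char_poly A) t = det (t \<cdot>\<^sub>m 1\<^sub>m n - A)"
proof -
  have "- char_matrix A t = t \<cdot>\<^sub>m 1\<^sub>m n - A"
    using assms by (intro eq_matI) (auto simp: char_matrix_def)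
  then show ?thesis
    using char_poly_matrix[OF assms] by simp
qed

text \<open>
  On vectors \<open>f\<close> with \<open>N f = c f\<close> the matrix \<open>t + 2 N\<close> acts as the scalar \<open>t + 2 c\<close>. This determines
  the solution \<open>E\<close> of \<open>(t + 2 N) E = K\<close> from \<open>K\<close>, \<open>F = N K\<close>, \<open>c\<close> and \<open>t\<close> alone: it is
  \<open>E = (1 / t) (K - 2 / (t + 2 c) F)\<close>, without any further reference to \<open>N\<close>.
\<close>

lemma shifted_matrix_factorization:
  fixes K F N :: "real mat"
  assumes K: "K \<in> carrier_mat n n" and N: "N \<in> carrier_mat n n" and F: "F \<in> carrier_mat n n"
    and NK: "N * K = F" and NF: "N * F = c \<cdot>\<^sub>m F"
    and c: "0 \<le> c" and t: "0 < t"
  shows "t \<cdot>\<^sub>m 1\<^sub>m n - (K - 2 \<cdot>\<^sub>m N) =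
    (t \<cdot>\<^sub>m 1\<^sub>m n + 2 \<cdot>\<^sub>m N) * (1\<^sub>m n - (1 / t) \<cdot>\<^sub>m (K - (2 / (t + 2 * c)) \<cdot>\<^sub>m F))"
proof -
  define S d where "S = t \<cdot>\<^sub>m 1\<^sub>m n + 2 \<cdot>\<^sub>m N" and "d = 2 / (t + 2 * c)"
  define X where "X = K - d \<cdot>\<^sub>m F"
  have S: "S \<in> carrier_mat n n" and X: "X \<in> carrier_mat n n"
    using K N F by (auto simp: S_def X_def)
  have d: "2 - 2 * d * c = t * d"
    using c t by (simp add: d_def field_simps)
  have NX: "N * X = F - (d * c) \<cdot>\<^sub>m F"
    unfolding X_def mult_minus_distrib_mat[OF N K smult_carrier_mat[OF F]]
      mult_smult_distrib[OF N F] NK NF using F by (intro eq_matI) auto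
  have "S * X = t \<cdot>\<^sub>m X + 2 \<cdot>\<^sub>m (N * X)"
    unfolding S_def
    using add_mult_distrib_mat[OF smult_carrier_mat[OF one_carrier_mat] smult_carrier_mat[OF N] X]
      mult_smult_assoc_mat[OF one_carrier_mat X] mult_smult_assoc_mat[OF N X] X by simp
  also have "\<dots> = t \<cdot>\<^sub>m K"
  proof (rule eq_matI)
    fix i j assume ij: "i < dim_row (t \<cdot>\<^sub>m K)" "j < dim_col (t \<cdot>\<^sub>m K)"
    have "(t \<cdot>\<^sub>m X + 2 \<cdot>\<^sub>m (N * X)) $$ (i, j)
        = t * K $$ (i, j) + ((2 - 2 * d * c) - t * d) * F $$ (i, j)"
      unfolding NX using ij K F by (simp add: X_def algebra_simps)
    then show "(t \<cdot>\<^sub>m X + 2 \<cdot>\<^sub>m (N * X)) $$ (i, j) = (t \<cdot>\<^sub>m K) $$ (i, j)"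
      using ij d by simp
  qed (use K N X in auto)
  finally have SX: "S * X = t \<cdot>\<^sub>m K" .
  have "S * (1\<^sub>m n - (1 / t) \<cdot>\<^sub>m X) = S - (1 / t) \<cdot>\<^sub>m (S * X)"
    using mult_minus_distrib_mat[OF S one_carrier_mat smult_carrier_mat[OF X]]
      mult_smult_distrib[OF S X] S by simp
  also have "\<dots> = t \<cdot>\<^sub>m 1\<^sub>m n - (K - 2 \<cdot>\<^sub>m N)"
    unfolding SX unfolding S_def using K N t by (intro eq_matI) auto
  finally show ?thesis
    by (simp add: S_def X_def d_def)
qed

text \<open>
  By the factorization, \<open>det (t - (K - 2 N)) = det (t + 2 N) det (1 - E)\<close> for \<open>t > 0\<close>, with the same
  \<open>E\<close> for both choices of \<open>N\<close>. Two polynomials that agree for all \<open>t > 0\<close> are equal, and the factor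
  \<open>det (t + 2 N)\<close> has no positive root because \<open>N\<close> is positive semidefinite.
\<close>

lemma order_positive_root_perturbation:
  fixes K F N1 N2 :: "real mat"
  assumes K: "K \<in> carrier_mat n n" and F: "F \<in> carrier_mat n n"
    and N1: "psd_mat n N1" and N2: "psd_mat n N2"
    and NK: "N1 * K = F" "N2 * K = F" and NF: "N1 * F = c \<cdot>\<^sub>m F" "N2 * F = c \<cdot>\<^sub>m F"
    and c: "0 \<le> c" and x: "0 < x"
  shows "Polynomial.order x (char_poly (K - 2 \<cdot>\<^sub>m N1)) = Polynomial.order x (char_poly (K - 2 \<cdot>\<^sub>m N2))"
proof -
  have N: "N1 \<in> carrier_mat n n" "N2 \<in> carrier_mat n n"
    using N1 N2 by (auto simp: psd_mat_def)
  let ?p = "\<lambda>N. char_poly (K - 2 \<cdot>\<^sub>m N)" and ?s = "\<lambda>N. char_poly (- (2 \<cdot>\<^sub>m N))"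
  have s: "poly (?s M) t = det (t \<cdot>\<^sub>m 1\<^sub>m n + 2 \<cdot>\<^sub>m M)" if "M \<in> carrier_mat n n"
    for M :: "real mat" and t
  proof -
    have "t \<cdot>\<^sub>m 1\<^sub>m n - - (2 \<cdot>\<^sub>m M) = t \<cdot>\<^sub>m 1\<^sub>m n + 2 \<cdot>\<^sub>m M"
      using that by (intro eq_matI) auto
    then show ?thesis
      using that by (simp add: poly_char_poly[of _ n])
  qed
  have eq: "poly (?p N1 * ?s N2) t = poly (?p N2 * ?s N1) t" if t: "0 < t" for t
  proof -
    let ?E = "1\<^sub>m n - (1 / t) \<cdot>\<^sub>m (K - (2 / (t + 2 * c)) \<cdot>\<^sub>m F)"
    have "poly (?p M) t = poly (?s M) t * det ?E"
      if M: "M \<in> carrier_mat n n" and "M * K = F" "M * F = c \<cdot>\<^sub>m F" for M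
    proof -
      have "poly (?p M) t = det (t \<cdot>\<^sub>m 1\<^sub>m n - (K - 2 \<cdot>\<^sub>m M))"
        using K M by (intro poly_char_poly) auto
      also have "\<dots> = det (t \<cdot>\<^sub>m 1\<^sub>m n + 2 \<cdot>\<^sub>m M) * det ?E"
        unfolding shifted_matrix_factorization[OF K M F that(2,3) c t]
        using K F M by (intro det_mult[of _ n]) auto
      finally show ?thesis
        by (simp add: s[OF M])
    qed
    then show ?thesis
      using N NK NF by simp
  qed
  have "?p N1 * ?s N2 - ?p N2 * ?s N1 = 0"
  proof (rule ccontr)
    assume "?p N1 * ?s N2 - ?p N2 * ?s N1 \<noteq> 0"
    then have "finite {t. poly (?p N1 * ?s N2 - ?p N2 * ?s N1) t = 0}"
      by (rule poly_roots_finite)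
    then have "finite {0 :: real<..}"
      by (rule rev_finite_subset) (use eq in auto)
    then show False
      by (simp add: infinite_Ioi)
  qed
  then have prod: "?p N1 * ?s N2 = ?p N2 * ?s N1"
    by simp
  have nz: "?p M \<noteq> 0" "?s M \<noteq> 0" if "M \<in> carrier_mat n n" for M
  proof -
    have "char_poly B \<noteq> 0" if "B \<in> carrier_mat n n" for B :: "real mat"
      using degree_monic_char_poly[OF that] by auto
    then show "?p M \<noteq> 0" "?s M \<noteq> 0"
      using that by (simp_all add: minus_carrier_mat)
  qed
  have s0: "Polynomial.order x (?s M) = 0" if "psd_mat n M" for M
    using det_shifted_psd_neq_0[OF that x] that by (intro order_0I) (simp add: psd_mat_def s)
  show ?thesis
    using arg_cong[OF prod, of "Polynomial.order x"] nz N s0[OF N1] s0[OF N2]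
    by (simp add: order_mult)
qed

section \<open>Matrices indexed by lists\<close>

text \<open>
  Matrices indexed by a list of vertices instead of by numbers, so that matrix products become sums
  over vertex sets and the order of the list can be changed.
\<close>

definition fun_mat :: "'v list \<Rightarrow> 'w list \<Rightarrow> ('v \<Rightarrow> 'w \<Rightarrow> real) \<Rightarrow> real mat" where
  "fun_mat us vs f = mat (length us) (length vs) (\<lambda>(i, j). f (us ! i) (vs ! j))"

lemma fun_mat_carrier [simp]: "fun_mat us vs f \<in> carrier_mat (length us) (length vs)"
  by (simp add: fun_mat_def)

lemma fun_mat_cong:
  assumes "\<And>u v. u \<in> set us \<Longrightarrow> v \<in> set vs \<Longrightarrow> f u v = g u v"
  shows "fun_mat us vs f = fun_mat us vs g"
  unfolding fun_mat_def by (intro cong_mat) (auto intro: assms)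

lemma sum_nth_distinct:
  assumes "distinct vs"
  shows "(\<Sum>k<length vs. h (vs ! k)) = sum h (set vs)"
  using sum.reindex_bij_betw[OF bij_betw_nth[OF assms refl refl], of h] by simp

lemma fun_mat_mult:
  assumes "distinct vs"
  shows "fun_mat us vs f * fun_mat vs ws g = fun_mat us ws (\<lambda>u w. \<Sum>v\<in>set vs. f u v * g v w)"
  by (intro eq_matI)
    (auto simp: fun_mat_def scalar_prod_def atLeast0LessThan
      sum_nth_distinct[OF assms, symmetric])

text \<open>
  The matrix of the equality relation between the two listings is the conjugating permutation
  matrix.
\<close>

lemma fun_mat_reorder_similar:
  assumes "distinct vs" "distinct ws" "set vs = set ws"
  shows "similar_mat (fun_mat vs vs f) (fun_mat ws ws f)"
proof -
  have len: "length ws = length vs"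
    using assms by (metis distinct_card)
  let ?P = "\<lambda>us us'. fun_mat us us' (\<lambda>u v. if u = v then 1 else 0)"
  have delta: "(\<Sum>v\<in>S. (if u = v then 1 else 0) * g v) = g u"
    "(\<Sum>v\<in>S. g v * (if v = u then 1 else 0)) = g u"
    if "u \<in> S" "finite S" for S and u :: 'a and g :: "'a \<Rightarrow> real"
  proof -
    have "(\<Sum>v\<in>S. (if u = v then 1 else 0) * g v) = (\<Sum>v\<in>S. if u = v then g v else 0)"
      "(\<Sum>v\<in>S. g v * (if v = u then 1 else 0)) = (\<Sum>v\<in>S. if u = v then g v else 0)"
      by (auto intro: sum.cong)
    then show "(\<Sum>v\<in>S. (if u = v then 1 else 0) * g v) = g u"
      "(\<Sum>v\<in>S. g v * (if v = u then 1 else 0)) = g u"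
      using that by simp_all
  qed
  have inv: "?P us us' * ?P us' us = 1\<^sub>m (length us)"
    if "distinct us" "distinct us'" "set us' = set us" for us us' :: "'a list"
  proof -
    have "?P us us' * ?P us' us = fun_mat us us (\<lambda>u v. if u = v then 1 else 0)"
      unfolding fun_mat_mult[OF that(2)] by (intro fun_mat_cong delta) (use that in auto)
    also have "\<dots> = 1\<^sub>m (length us)"
      using that by (intro eq_matI) (auto simp: fun_mat_def nth_eq_iff_index_eq)
    finally show ?thesis .
  qed
  have "?P vs ws * fun_mat ws ws f * ?P ws vs = ?P vs ws * (fun_mat ws ws f * ?P ws vs)"
    by (rule assoc_mult_mat[of _ "length vs" "length ws" _ "length ws" _ "length vs"]) auto
  also have "fun_mat ws ws f * ?P ws vs = fun_mat ws vs f"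
    unfolding fun_mat_mult[OF assms(2)] by (intro fun_mat_cong delta) (use assms in auto)
  also have "?P vs ws * fun_mat ws vs f = fun_mat vs vs f"
    unfolding fun_mat_mult[OF assms(2)] by (intro fun_mat_cong delta) (use assms in auto)
  finally have "fun_mat vs vs f = ?P vs ws * fun_mat ws ws f * ?P ws vs" ..
  moreover have "?P vs ws * ?P ws vs = 1\<^sub>m (length vs)" "?P ws vs * ?P vs ws = 1\<^sub>m (length vs)"
    using inv[of vs ws] inv[of ws vs] assms len by simp_all
  ultimately show ?thesis
    using len by (intro similar_matI[of _ _ _ _ "length vs"]) (auto simp: fun_mat_def)
qed

lemma spectral_energy_similar:
  assumes "similar_mat A B"
  shows "spectral_energy A = spectral_energy B"
proof -
  obtain n where "A \<in> carrier_mat n n" "B \<in> carrier_mat n n"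
    using similar_matD[OF assms] by auto
  then show ?thesis
    using char_poly_similar[OF assms]
    by (simp add: spectral_energy_def eigenvalue_root_char_poly)
qed

lemma psd_mat_gram:
  assumes f: "\<And>u v. u \<in> set vs \<Longrightarrow> v \<in> set vs \<Longrightarrow> f u v = (\<Sum>c\<in>C. g u c * g v c)"
  shows "psd_mat (length vs) (fun_mat vs vs f)"
  unfolding psd_mat_def
proof (intro conjI ballI)
  fix x :: "real vec" assume x: "x \<in> carrier_vec (length vs)"
  let ?n = "length vs"
  have "x \<bullet> (fun_mat vs vs f *\<^sub>v x)
      = (\<Sum>i<?n. \<Sum>j<?n. \<Sum>c\<in>C. (x $ i * g (vs ! i) c) * (x $ j * g (vs ! j) c))"
    using x f by (auto simp: scalar_prod_def fun_mat_def atLeast0LessThan sum_distrib_left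
        sum_distrib_right mult_ac intro!: sum.cong)
  also have "\<dots> = (\<Sum>i<?n. \<Sum>c\<in>C. \<Sum>j<?n. (x $ i * g (vs ! i) c) * (x $ j * g (vs ! j) c))"
    by (intro sum.cong refl sum.swap)
  also have "\<dots> = (\<Sum>c\<in>C. \<Sum>i<?n. \<Sum>j<?n. (x $ i * g (vs ! i) c) * (x $ j * g (vs ! j) c))"
    by (rule sum.swap)
  also have "\<dots> = (\<Sum>c\<in>C. (\<Sum>i<?n. x $ i * g (vs ! i) c)\<^sup>2)"
    by (simp add: power2_eq_square sum_product)
  finally show "0 \<le> x \<bullet> (fun_mat vs vs f *\<^sub>v x)"
    by (simp add: sum_nonneg)
qed auto

lemma spectral_energy_psd_perturbation:
  fixes K F N1 N2 :: "real mat"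
  assumes K: "K \<in> carrier_mat n n" and F: "F \<in> carrier_mat n n"
    and N1: "psd_mat n N1" and N2: "psd_mat n N2"
    and NK: "N1 * K = F" "N2 * K = F" and NF: "N1 * F = c \<cdot>\<^sub>m F" "N2 * F = c \<cdot>\<^sub>m F"
    and c: "0 \<le> c"
    and sym: "\<And>N i j. N \<in> {N1, N2} \<Longrightarrow> i < n \<Longrightarrow> j < n \<Longrightarrow>
      (K - 2 \<cdot>\<^sub>m N) $$ (i, j) = (K - 2 \<cdot>\<^sub>m N) $$ (j, i)"
    and diag: "\<And>N i. N \<in> {N1, N2} \<Longrightarrow> i < n \<Longrightarrow> (K - 2 \<cdot>\<^sub>m N) $$ (i, i) = 0"
  shows "spectral_energy (K - 2 \<cdot>\<^sub>m N1) = spectral_energy (K - 2 \<cdot>\<^sub>m N2)"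
proof -
  have carrier: "K - 2 \<cdot>\<^sub>m N \<in> carrier_mat n n" if "N \<in> {N1, N2}" for N
    using that N1 N2 by (auto simp: psd_mat_def)
  have "spectral_energy (K - 2 \<cdot>\<^sub>m N) =
    2 * (\<Sum>x | 0 < x \<and> Polynomial.order x (char_poly (K - 2 \<cdot>\<^sub>m N)) \<noteq> 0.
          real (Polynomial.order x (char_poly (K - 2 \<cdot>\<^sub>m N))) * x)" if "N \<in> {N1, N2}" for N
    by (rule spectral_energy_trace_0[OF carrier[OF that] sym[OF that] diag[OF that]])
  then show ?thesis
    using order_positive_root_perturbation[OF K F N1 N2 NK NF c] by (auto intro!: sum.cong)
qed

section \<open>Edges of simple graphs\<close>

lemma graph_edge_pair:
  assumes "pair_graph X" "e \<in> graph_edges X"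
  obtains u v where "e = {u, v}" "u \<noteq> v" "u \<in> pverts X" "v \<in> pverts X" "(u, v) \<in> parcs X"
proof -
  interpret pair_graph X by fact
  obtain u v where "e = {u, v}" "(u, v) \<in> parcs X"
    using assms(2) by (auto simp: graph_edges_def)
  then show ?thesis
    using that pair_no_loops[of "(u, v)"] in_arcsD1[of u v] in_arcsD2[of u v] by auto
qed

lemma graph_edge_card: "pair_graph X \<Longrightarrow> e \<in> graph_edges X \<Longrightarrow> card e = 2"
  by (erule graph_edge_pair) auto

lemma graph_edge_subset: "pair_graph X \<Longrightarrow> e \<in> graph_edges X \<Longrightarrow> e \<subseteq> pverts X"
  by (erule graph_edge_pair) auto

lemma finite_pverts: "pair_graph X \<Longrightarrow> finite (pverts X)"
  by (simp add: pair_graph_def pair_digraph_def pair_fin_digraph.pair_finite_verts)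

lemma finite_graph_edges: "pair_graph X \<Longrightarrow> finite (graph_edges X)"
  by (rule finite_subset[of _ "Pow (pverts X)"]) (auto dest: graph_edge_subset finite_pverts)

lemma card_incident_edges:
  assumes X: "pair_graph X" and reg: "regular_graph k X" and v: "v \<in> pverts X"
  shows "card {e \<in> graph_edges X. v \<in> e} = k"
proof -
  interpret pair_graph X by fact
  have sym: "(w, u) \<in> parcs X" if "(u, w) \<in> parcs X" for u w
    using that pair_sym_arcs by (auto simp: symmetric_def dest: symD)
  have "bij_betw (\<lambda>a. {fst a, snd a}) (out_arcs (with_proj X) v) {e \<in> graph_edges X. v \<in> e}"
  proof (rule bij_betw_imageI)
    show "inj_on (\<lambda>a. {fst a, snd a}) (out_arcs (with_proj X) v)"
      by (auto simp: inj_on_def doubleton_eq_iff)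
    show "(\<lambda>a. {fst a, snd a}) ` out_arcs (with_proj X) v = {e \<in> graph_edges X. v \<in> e}"
    proof (intro equalityI subsetI)
      fix e assume "e \<in> {e \<in> graph_edges X. v \<in> e}"
      then obtain w where "e = {v, w}" "(v, w) \<in> parcs X"
        by (auto simp: graph_edges_def dest: sym)
      then show "e \<in> (\<lambda>a. {fst a, snd a}) ` out_arcs (with_proj X) v"
        by (intro image_eqI[of _ _ "(v, w)"]) auto
    next
      fix e assume "e \<in> (\<lambda>a. {fst a, snd a}) ` out_arcs (with_proj X) v"
      then obtain w where "e = {v, w}" "(v, w) \<in> parcs X"
        by auto
      then show "e \<in> {e \<in> graph_edges X. v \<in> e}"
        unfolding graph_edges_def by blast
    qed
  qed
  then have "card {e \<in> graph_edges X. v \<in> e} = out_degree (with_proj X) v"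
    unfolding out_degree_def by (simp add: bij_betw_same_card)
  then show ?thesis
    using reg v by (simp add: regular_graph_def)
qed

text \<open>
  Double counting of incidences between vertices and edges.
\<close>

lemma handshake_regular:
  assumes X: "pair_graph X" and reg: "regular_graph k X"
  shows "2 * card (graph_edges X) = k * card (pverts X)"
proof -
  have "(\<Sum>e\<in>graph_edges X. card {v \<in> pverts X. v \<in> e}) = k * card (pverts X)"
    by (rule sum_multicount)
      (use finite_pverts[OF X] finite_graph_edges[OF X] card_incident_edges[OF X reg] in auto)
  also have "(\<Sum>e\<in>graph_edges X. card {v \<in> pverts X. v \<in> e}) = (\<Sum>e\<in>graph_edges X. 2)"
  proof (rule sum.cong)
    fix e assume e: "e \<in> graph_edges X"
    then have "{v \<in> pverts X. v \<in> e} = e"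
      using graph_edge_subset[OF X] by blast
    then show "card {v \<in> pverts X. v \<in> e} = 2"
      using graph_edge_card[OF X e] by simp
  qed simp
  finally show ?thesis
    by simp
qed

section \<open>Structure and connectedness of the join\<close>

lemma pverts_subdivision [simp]:
  "Inl v \<in> pverts (subdivision_graph X) \<longleftrightarrow> v \<in> pverts X"
  "Inr e \<in> pverts (subdivision_graph X) \<longleftrightarrow> e \<in> graph_edges X"
  by (auto simp: subdivision_graph_def)

lemma parcs_subdivision [simp]:
  "(Inl v, Inr e) \<in> parcs (subdivision_graph X) \<longleftrightarrow> e \<in> graph_edges X \<and> v \<in> e"
  "(Inr e, Inl v) \<in> parcs (subdivision_graph X) \<longleftrightarrow> e \<in> graph_edges X \<and> v \<in> e"
  "(Inl v, Inl w) \<notin> parcs (subdivision_graph X)"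
  "(Inr e, Inr f) \<notin> parcs (subdivision_graph X)"
  by (auto simp: subdivision_graph_def)

lemma pverts_join [simp]:
  "Inl s \<in> pverts (X \<circledcirc> Y) \<longleftrightarrow> s \<in> pverts (subdivision_graph X)"
  "Inr t \<in> pverts (X \<circledcirc> Y) \<longleftrightarrow> t \<in> pverts (subdivision_graph Y)"
  by (auto simp: subdivision_vv_join_def)

lemma parcs_join [simp]:
  "(Inl s, Inl s') \<in> parcs (X \<circledcirc> Y) \<longleftrightarrow> (s, s') \<in> parcs (subdivision_graph X)"
  "(Inr t, Inr t') \<in> parcs (X \<circledcirc> Y) \<longleftrightarrow> (t, t') \<in> parcs (subdivision_graph Y)"
  "(Inl s, Inr t) \<in> parcs (X \<circledcirc> Y) \<longleftrightarrow> s \<in> Inl ` pverts X \<and> t \<in> Inl ` pverts Y"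
  "(Inr t, Inl s) \<in> parcs (X \<circledcirc> Y) \<longleftrightarrow> s \<in> Inl ` pverts X \<and> t \<in> Inl ` pverts Y"
  by (auto simp: subdivision_vv_join_def)

lemma pair_sym_digraph_join:
  assumes X: "pair_graph X" and Y: "pair_graph Y"
  shows "pair_sym_digraph (X \<circledcirc> Y)"
proof -
  have ends: "a \<in> pverts (X \<circledcirc> Y) \<and> b \<in> pverts (X \<circledcirc> Y) \<and> (b, a) \<in> parcs (X \<circledcirc> Y)"
    if "(a, b) \<in> parcs (X \<circledcirc> Y)" for a b
    using that graph_edge_subset[OF X] graph_edge_subset[OF Y]
    by (cases a; cases b; rename_tac s t; case_tac s; case_tac t) auto
  show ?thesis
    by unfold_locales (use ends in \<open>auto simp: symmetric_def intro: symI\<close>)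
qed

lemma finite_join:
  assumes "pair_graph X" "pair_graph Y"
  shows "finite (pverts (X \<circledcirc> Y))"
  using assms by (simp add: subdivision_vv_join_def subdivision_graph_def finite_pverts finite_graph_edges)

text \<open>
  A walk in \<open>X\<close> becomes a walk in the join by passing through the inserted vertices. So all vertices
  of \<open>X\<close> are reachable from one of them, then all vertices of \<open>Y\<close>, and finally every inserted vertex
  from an end of its edge. This covers an empty \<open>Y\<close> too, where the join is the subdivision of \<open>X\<close>.
\<close>

lemma connected_join:
  assumes X: "pair_graph X" and Y: "pair_graph Y" and conn: "connected_graph X"
  shows "connected_graph (X \<circledcirc> Y)"
proof -
  interpret X: pair_graph X by fact
  interpret Z: pair_sym_digraph "X \<circledcirc> Y" by (rule pair_sym_digraph_join[OF X Y])
  let ?R = "\<lambda>x y. x \<rightarrow>\<^sup>*\<^bsub>with_proj (X \<circledcirc> Y)\<^esub> y"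
  have "strongly_connected (mk_symmetric (with_proj X))"
    using conn by (simp add: connected_graph_def connected_def)
  then obtain r where r: "r \<in> pverts X"
    and reach: "\<And>v. v \<in> pverts X \<Longrightarrow> r \<rightarrow>\<^sup>*\<^bsub>with_proj X\<^esub> v"
    using X.reachable_mk_symmetric_eq[OF X.pair_sym_arcs]
    by (auto simp: strongly_connected_def)
  have adj: "?R x z" if "?R x y" "(y, z) \<in> parcs (X \<circledcirc> Y)" for x y z
    using that Z.reachable_adj_trans by simp
  have root_X: "?R (Inl (Inl r)) (Inl (Inl v))" if "v \<in> pverts X" for v
    using reach[OF that]
  proof (induct rule: X.reachable_induct)
    case base
    then show ?case using r by simp
  next
    case (step u w)
    then have e: "{u, w} \<in> graph_edges X"
      by (auto simp: graph_edges_def)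
    show ?case
      by (rule adj[OF adj[OF step(3), of "Inl (Inr {u, w})"]]) (use e in auto)
  qed
  have root_Y: "?R (Inl (Inl r)) (Inr (Inl w))" if "w \<in> pverts Y" for w
    by (rule adj[OF root_X[OF r]]) (use r that in auto)
  have root: "?R (Inl (Inl r)) x" if x: "x \<in> pverts (X \<circledcirc> Y)" for x
  proof (cases x)
    case (Inl s)
    show ?thesis
    proof (cases s)
      case (Inr e)
      then have e: "e \<in> graph_edges X" using x \<open>x = Inl s\<close> by simp
      from graph_edge_pair[OF X e] obtain v where "v \<in> e" "v \<in> pverts X" by auto
      then show ?thesis
        using adj[OF root_X, of v x] e Inr Inl by simp
    qed (use Inl x root_X in auto)
  next
    case (Inr t)
    show ?thesis
    proof (cases t)
      case (Inr e)
      then have e: "e \<in> graph_edges Y" using x \<open>x = Inr t\<close> by simp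
      from graph_edge_pair[OF Y e] obtain v where "v \<in> e" "v \<in> pverts Y" by auto
      then show ?thesis
        using adj[OF root_Y, of v x] e Inr \<open>x = Inr t\<close> by simp
    qed (use Inr x root_Y in auto)
  qed
  have "?R x y" if "x \<in> pverts (X \<circledcirc> Y)" "y \<in> pverts (X \<circledcirc> Y)" for x y
    using Z.reachable_trans[OF Z.symmetric_reachable'[OF root[OF that(1)]] root[OF that(2)]] .
  moreover have "pverts (X \<circledcirc> Y) \<noteq> {}"
    using pverts_join(1)[of "Inl r" X Y] r unfolding pverts_subdivision by blast
  ultimately have "strongly_connected (mk_symmetric (with_proj (X \<circledcirc> Y)))"
    using Z.reachable_mk_symmetric_eq[OF Z.pair_sym_arcs] by (simp add: strongly_connected_def)
  then show ?thesis
    by (simp add: connected_graph_def connected_def)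
qed

section \<open>Distances in the join\<close>

text \<open>
  A certificate for distances from \<open>x\<close>: the Lipschitz condition makes \<open>f\<close> a lower bound for the length
  of every walk, and following the descent condition back to \<open>x\<close> yields a walk of length \<open>f y\<close>.
\<close>

lemma graph_dist_eqI:
  fixes f :: "'a \<Rightarrow> nat"
  assumes wf: "pair_wf_digraph X" and x: "x \<in> pverts X" and y: "y \<in> pverts X"
    and start: "f x = 0"
    and lipschitz: "\<And>a b. (a, b) \<in> parcs X \<Longrightarrow> f b \<le> Suc (f a)"
    and unique: "\<And>b. b \<in> pverts X \<Longrightarrow> f b = 0 \<Longrightarrow> b = x"
    and descent: "\<And>b. b \<in> pverts X \<Longrightarrow> f b \<noteq> 0 \<Longrightarrow> \<exists>a. (a, b) \<in> parcs X \<and> f b = Suc (f a)"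
  shows "graph_dist X x y = real (f y)"
proof -
  interpret pair_wf_digraph X by fact
  have cost: "awalk_cost (\<lambda>_. 1) p = real (length p)" for p :: "('a \<times> 'a) list"
    by (induct p) (simp_all add: awalk_cost_def)
  have lower: "f b \<le> f a + length p" if "awalk a p b" for a b p
    using that
  proof (induct p arbitrary: a)
    case (Cons e p)
    then have "awalk (snd e) p b" "e \<in> parcs X" "fst e = a"
      by (auto simp: awalk_Cons_iff)
    then show ?case
      using Cons.hyps[of "snd e"] lipschitz[of "fst e" "snd e"] by force
  qed (simp add: awalk_Nil_iff)
  have upper: "\<exists>p. awalk x p b \<and> length p = f b" if "b \<in> pverts X" for b
    using that
  proof (induct "f b" arbitrary: b)
    case 0
    then show ?case
      using unique[of b] x by (intro exI[of _ "[]"]) (simp add: awalk_Nil_iff)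
  next
    case (Suc n)
    then obtain a where a: "(a, b) \<in> parcs X" "f b = Suc (f a)"
      using descent[of b] by auto
    then obtain p where "awalk x p a" "length p = f a"
      using Suc.hyps(1)[of a] Suc.hyps(2) in_arcsD1 by auto
    then show ?case
      using a in_arcsD2[OF a(1)]
      by (intro exI[of _ "p @ [(a, b)]"]) (auto simp: awalk_append_iff awalk_Cons_iff awalk_Nil_iff)
  qed
  have "wf_digraph.\<mu> (with_proj X) (\<lambda>_. 1) x y = ereal (real (f y))"
    unfolding \<mu>_def
  proof (rule antisym)
    obtain p where "awalk x p y" "length p = f y"
      using upper[OF y] by auto
    then show "(INF p\<in>{p. awalk x p y}. ereal (awalk_cost (\<lambda>_. 1) p)) \<le> ereal (real (f y))"
      by (intro INF_lower2[of p]) (auto simp: cost)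
    show "ereal (real (f y)) \<le> (INF p\<in>{p. awalk x p y}. ereal (awalk_cost (\<lambda>_. 1) p))"
      by (intro INF_greatest) (use lower start in \<open>force simp: cost\<close>)
  qed
  then show ?thesis
    by (simp add: graph_dist_def)
qed

text \<open>
  A vertex of a subdivision graph has depth 0 or 1, its distance to the original vertices; its ends
  are the nearest original vertices.
\<close>

definition depth :: "'a + 'a set \<Rightarrow> nat" where
  "depth s = (case s of Inl _ \<Rightarrow> 0 | Inr _ \<Rightarrow> 1)"

definition ends :: "'a + 'a set \<Rightarrow> 'a set" where
  "ends s = (case s of Inl v \<Rightarrow> {v} | Inr e \<Rightarrow> e)"

lemma depth_simps [simp]: "depth (Inl v) = 0" "depth (Inr e) = 1"
  by (simp_all add: depth_def)

lemma ends_simps [simp]: "ends (Inl v) = {v}" "ends (Inr e) = e"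
  by (simp_all add: ends_def)

text \<open>
  The distance in the join between two vertices that come from the same graph, when the other graph
  is nonempty. The vertices of the other graph are then common neighbours of all original vertices
  here, so any two of these are at distance at most 2, whatever the graph looks like.
\<close>

fun same_side_dist :: "'a + 'a set \<Rightarrow> 'a + 'a set \<Rightarrow> nat" where
  "same_side_dist (Inl u) (Inl v) = (if u = v then 0 else 2)"
| "same_side_dist (Inl u) (Inr f) = (if u \<in> f then 1 else 3)"
| "same_side_dist (Inr e) (Inl v) = (if v \<in> e then 1 else 3)"
| "same_side_dist (Inr e) (Inr f) = (if e = f then 0 else if e \<inter> f \<noteq> {} then 2 else 4)"

fun join_dist :: "('a + 'a set) + ('b + 'b set) \<Rightarrow> ('a + 'a set) + ('b + 'b set) \<Rightarrow> nat" where
  "join_dist (Inl s) (Inl t) = same_side_dist s t"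
| "join_dist (Inr s) (Inr t) = same_side_dist s t"
| "join_dist (Inl s) (Inr t) = 1 + depth s + depth t"
| "join_dist (Inr s) (Inl t) = 1 + depth s + depth t"

lemma join_dist_commute: "join_dist x y = join_dist y x"
proof -
  have "same_side_dist s t = same_side_dist t s" for s t :: "'c + 'c set"
    by (cases s; cases t) (auto simp: Int_commute)
  then show ?thesis
    by (cases x; cases y) (simp_all add: add_ac)
qed

lemma same_side_dist_lipschitz:
  assumes "(t, t') \<in> parcs (subdivision_graph Z)"
  shows "same_side_dist s t' \<le> Suc (same_side_dist s t)"
  using assms by (cases s; cases t; cases t') auto

lemma same_side_dist_vertex_bounds:
  "depth s \<le> same_side_dist s (Inl v)" "same_side_dist s (Inl v) \<le> 2 + depth s"
  by (cases s; simp)+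

lemma depth_le_Suc: "depth t \<le> Suc (depth t')"
  by (cases t; cases t') auto

lemma join_dist_lipschitz:
  assumes "(a, b) \<in> parcs (X \<circledcirc> Y)"
  shows "join_dist x b \<le> Suc (join_dist x a)"
  using assms same_side_dist_lipschitz[of _ _ X] same_side_dist_lipschitz[of _ _ Y]
  by (cases x; cases a; cases b)
    (auto simp: same_side_dist_vertex_bounds same_side_dist_vertex_bounds(2)[simplified] depth_le_Suc)

lemma same_side_dist_eq_0:
  "same_side_dist s t = 0 \<longleftrightarrow> s = t"
  by (cases s; cases t) auto

text \<open>
  A last step of a shortest walk can be chosen on the side of \<open>s\<close> and \<open>t\<close>, except when \<open>t\<close> is an
  original vertex that is no end of \<open>s\<close>: then the walk arrives from the other side.
\<close>

lemma same_side_descent: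
  assumes Z: "pair_graph Z" and s: "s \<in> pverts (subdivision_graph Z)"
    and t: "t \<in> pverts (subdivision_graph Z)" and neq: "s \<noteq> t"
  shows "(\<exists>t'. (t', t) \<in> parcs (subdivision_graph Z) \<and> same_side_dist s t = Suc (same_side_dist s t'))
    \<or> (t \<in> Inl ` pverts Z \<and> same_side_dist s t = 2 + depth s)"
proof (cases t)
  case (Inl v)
  then show ?thesis
    using neq s t by (cases s) (auto intro!: exI[of _ s])
next
  case (Inr f)
  then have f: "f \<in> graph_edges Z"
    using t by simp
  then obtain v w where vw: "f = {v, w}" "v \<noteq> w"
    using graph_edge_pair[OF Z] by metis
  have "\<exists>u\<in>f. same_side_dist s t = Suc (same_side_dist s (Inl u))"
    using neq Inr vw by (cases s) auto
  then obtain u where "u \<in> f" "same_side_dist s t = Suc (same_side_dist s (Inl u))" ..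
  then show ?thesis
    using f Inr by (intro disjI1 exI[of _ "Inl u"]) simp
qed

lemma join_dist_descent:
  assumes X: "pair_graph X" and Y: "pair_graph Y"
    and nonempty: "pverts X \<noteq> {}" "pverts Y \<noteq> {}"
    and x: "x \<in> pverts (X \<circledcirc> Y)" and y: "y \<in> pverts (X \<circledcirc> Y)" and neq: "x \<noteq> y"
  shows "\<exists>z. (z, y) \<in> parcs (X \<circledcirc> Y) \<and> join_dist x y = Suc (join_dist x z)"
proof -
  obtain u w where uw: "u \<in> pverts X" "w \<in> pverts Y"
    using nonempty by auto
  consider (XX) s t where "x = Inl s" "y = Inl t" | (YY) s t where "x = Inr s" "y = Inr t"
    | (XY) s t where "x = Inl s" "y = Inr t" | (YX) s t where "x = Inr s" "y = Inl t"
    by (cases x; cases y) auto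
  then show ?thesis
  proof cases
    case XX
    then show ?thesis
      using same_side_descent[OF X, of s t] x y neq uw
      by (auto intro: exI[of _ "Inl z" for z] exI[of _ "Inr (Inl w)"])
  next
    case YY
    then show ?thesis
      using same_side_descent[OF Y, of s t] x y neq uw
      by (auto intro: exI[of _ "Inr z" for z] exI[of _ "Inl (Inl u)"])
  next
    case XY
    show ?thesis
    proof (cases t)
      case (Inl v)
      show ?thesis
      proof (cases s)
        case (Inl a)
        then show ?thesis
          using XY \<open>t = Inl v\<close> x y by (intro exI[of _ x]) auto
      next
        case (Inr e)
        then obtain a where "a \<in> e" "a \<in> pverts X"
          using XY x graph_edge_pair[OF X, of e] by auto
        then show ?thesis
          using XY Inr \<open>t = Inl v\<close> x y by (intro exI[of _ "Inl (Inl a)"]) auto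
      qed
    next
      case (Inr e)
      then obtain a where "a \<in> e" "a \<in> pverts Y"
        using XY y graph_edge_pair[OF Y, of e] by auto
      then show ?thesis
        using XY Inr x y by (intro exI[of _ "Inr (Inl a)"]) auto
    qed
  next
    case YX
    show ?thesis
    proof (cases t)
      case (Inl v)
      show ?thesis
      proof (cases s)
        case (Inl a)
        then show ?thesis
          using YX \<open>t = Inl v\<close> x y by (intro exI[of _ x]) auto
      next
        case (Inr e)
        then obtain a where "a \<in> e" "a \<in> pverts Y"
          using YX x graph_edge_pair[OF Y, of e] by auto
        then show ?thesis
          using YX Inr \<open>t = Inl v\<close> x y by (intro exI[of _ "Inr (Inl a)"]) auto
      qed
    next
      case (Inr e)
      then obtain a where "a \<in> e" "a \<in> pverts X"
        using YX y graph_edge_pair[OF X, of e] by auto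
      then show ?thesis
        using YX Inr x y by (intro exI[of _ "Inl (Inl a)"]) auto
    qed
  qed
qed

lemma graph_dist_join:
  assumes X: "pair_graph X" and Y: "pair_graph Y"
    and nonempty: "pverts X \<noteq> {}" "pverts Y \<noteq> {}"
    and x: "x \<in> pverts (X \<circledcirc> Y)" and y: "y \<in> pverts (X \<circledcirc> Y)"
  shows "graph_dist (X \<circledcirc> Y) x y = real (join_dist x y)"
proof (rule graph_dist_eqI)
  have eq_0: "join_dist x b = 0 \<longleftrightarrow> x = b" for b
    by (cases x; cases b) (auto simp: same_side_dist_eq_0)
  show "pair_wf_digraph (X \<circledcirc> Y)"
    using pair_sym_digraph_join[OF X Y] by (simp add: pair_sym_digraph_def)
  show "join_dist x x = 0" "\<And>b. join_dist x b = 0 \<Longrightarrow> b = x"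
    by (simp_all add: eq_0)
  show "join_dist x b \<le> Suc (join_dist x a)" if "(a, b) \<in> parcs (X \<circledcirc> Y)" for a b
    using that by (rule join_dist_lipschitz)
  show "\<exists>a. (a, b) \<in> parcs (X \<circledcirc> Y) \<and> join_dist x b = Suc (join_dist x a)"
    if "b \<in> pverts (X \<circledcirc> Y)" "join_dist x b \<noteq> 0" for b
    using join_dist_descent[OF X Y nonempty x that(1)] that(2) eq_0 by metis
qed (use x y in auto)

text \<open>
  Each common end saves two steps on the way that crosses to the other side and back, which has
  length \<open>2 + depth s + depth t\<close>. Distinct edges of a simple graph have at most one common end.
\<close>

lemma same_side_dist_eq_overlap:
  assumes Z: "pair_graph Z" and s: "s \<in> pverts (subdivision_graph Z)"
    and t: "t \<in> pverts (subdivision_graph Z)"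
  shows "real (same_side_dist s t)
    = 2 + real (depth s) + real (depth t) - 2 * real (card (ends s \<inter> ends t))"
proof (cases s)
  case (Inl u)
  then show ?thesis
    by (cases t) auto
next
  case (Inr e)
  show ?thesis
  proof (cases t)
    case (Inl v)
    then show ?thesis
      using \<open>s = Inr e\<close> by auto
  next
    case (Inr f)
    obtain u v where uv: "e = {u, v}" "u \<noteq> v"
      using s \<open>s = Inr e\<close> graph_edge_pair[OF Z, of e] by (metis pverts_subdivision(2))
    obtain u' v' where uv': "f = {u', v'}" "u' \<noteq> v'"
      using t Inr graph_edge_pair[OF Z, of f] by (metis pverts_subdivision(2))
    show ?thesis
      using \<open>s = Inr e\<close> Inr uv uv' by (auto simp: doubleton_eq_iff)
  qed
qed

section \<open>The distance matrix as a flat part minus a Gram matrix\<close>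

lemma ends_subset:
  assumes "pair_graph Z" "s \<in> pverts (subdivision_graph Z)"
  shows "ends s \<subseteq> pverts Z"
  using assms graph_edge_subset[of Z] by (cases s) auto

lemma card_ends:
  assumes "pair_graph Z" "s \<in> pverts (subdivision_graph Z)"
  shows "card (ends s) = Suc (depth s)"
  using assms graph_edge_card[of Z] by (cases s) auto

lemma overlap_eq_sum:
  assumes Z: "pair_graph Z" and s: "s \<in> pverts (subdivision_graph Z)"
  shows "real (card (ends s \<inter> ends t)) = (\<Sum>v\<in>pverts Z. of_bool (v \<in> ends s) * of_bool (v \<in> ends t))"
proof -
  have "(\<Sum>v\<in>pverts Z. of_bool (v \<in> ends s) * of_bool (v \<in> ends t) :: real)
      = (\<Sum>v\<in>pverts Z. of_bool (v \<in> ends s \<inter> ends t))"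
    by (rule sum.cong) auto
  also have "\<dots> = real (card (pverts Z \<inter> (ends s \<inter> ends t)))"
    using finite_pverts[OF Z] by (simp add: sum_of_bool_eq Int_def)
  also have "pverts Z \<inter> (ends s \<inter> ends t) = ends s \<inter> ends t"
    using ends_subset[OF Z s] by auto
  finally show ?thesis ..
qed

lemma sum_subdivision:
  fixes h :: "'a + 'a set \<Rightarrow> real"
  assumes Z: "pair_graph Z"
  shows "(\<Sum>t\<in>pverts (subdivision_graph Z). h t)
    = (\<Sum>v\<in>pverts Z. h (Inl v)) + (\<Sum>e\<in>graph_edges Z. h (Inr e))"
proof -
  have "(\<Sum>t\<in>pverts (subdivision_graph Z). h t)
      = (\<Sum>t\<in>Inl ` pverts Z. h t) + (\<Sum>t\<in>Inr ` graph_edges Z. h t)"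
    unfolding subdivision_graph_def using finite_pverts[OF Z] finite_graph_edges[OF Z]
    by (simp, intro sum.union_disjoint) auto
  then show ?thesis
    by (simp add: sum.reindex)
qed

text \<open>
  Counting pairs of an end \<open>v\<close> of \<open>s\<close> and a vertex \<open>t\<close> that has \<open>v\<close> as an end: for each \<open>v\<close> there is
  \<open>t = v\<close> itself, of depth 0, and the \<open>k\<close> edges at \<open>v\<close>, of depth 1. The result depends on \<open>s\<close> through
  its depth only; this is where regularity enters.
\<close>

lemma sum_overlap:
  fixes g :: "nat \<Rightarrow> real"
  assumes Z: "pair_graph Z" and reg: "regular_graph k Z" and s: "s \<in> pverts (subdivision_graph Z)"
  shows "(\<Sum>t\<in>pverts (subdivision_graph Z). real (card (ends s \<inter> ends t)) * g (depth t))
    = (1 + real (depth s)) * (g 0 + real k * g 1)"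
proof -
  let ?S = "pverts (subdivision_graph Z)"
  have fin: "finite (pverts Z)" "finite (graph_edges Z)"
    using Z by (auto intro: finite_pverts finite_graph_edges)
  have vertex: "(\<Sum>t\<in>?S. of_bool (v \<in> ends t) * g (depth t)) = g 0 + real k * g 1"
    if v: "v \<in> pverts Z" for v
  proof -
    have "(\<Sum>w\<in>pverts Z. of_bool (v = w) * g 0) = g 0"
      using v fin by (simp add: of_bool_def if_distrib[of "\<lambda>x. x * _"] cong: if_cong)
    moreover have "(\<Sum>e\<in>graph_edges Z. of_bool (v \<in> e) * g 1) = real k * g 1"
      using fin card_incident_edges[OF Z reg v]
      by (simp add: sum_distrib_right[symmetric] sum_of_bool_eq Int_def)
    ultimately show ?thesis
      by (simp add: sum_subdivision[OF Z])
  qed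
  have "(\<Sum>t\<in>?S. real (card (ends s \<inter> ends t)) * g (depth t))
      = (\<Sum>t\<in>?S. \<Sum>v\<in>pverts Z. of_bool (v \<in> ends s) * (of_bool (v \<in> ends t) * g (depth t)))"
    by (simp add: overlap_eq_sum[OF Z s] sum_distrib_right mult.assoc)
  also have "\<dots> = (\<Sum>v\<in>pverts Z. \<Sum>t\<in>?S. of_bool (v \<in> ends s) * (of_bool (v \<in> ends t) * g (depth t)))"
    by (rule sum.swap)
  also have "\<dots> = (\<Sum>v\<in>pverts Z. of_bool (v \<in> ends s) * (g 0 + real k * g 1))"
    by (simp add: sum_distrib_left[symmetric] vertex)
  also have "\<dots> = real (card (pverts Z \<inter> ends s)) * (g 0 + real k * g 1)"
    using fin by (simp add: sum_distrib_right[symmetric] sum_of_bool_eq Int_def)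
  also have "pverts Z \<inter> ends s = ends s"
    using ends_subset[OF Z s] by auto
  finally show ?thesis
    by (simp add: card_ends[OF Z s])
qed

text \<open>
  The distance, except that between two vertices of the second graph the saving for common ends is
  ignored. What remains depends on the second graph through depths only.
\<close>

definition flat_dist :: "('a + 'a set) + ('b + 'b set) \<Rightarrow> ('a + 'a set) + ('b + 'b set) \<Rightarrow> real" where
  "flat_dist x y = (case x of
       Inl s \<Rightarrow> (case y of Inl t \<Rightarrow> real (same_side_dist s t) | Inr t \<Rightarrow> 1 + real (depth s) + real (depth t))
     | Inr s \<Rightarrow> (case y of Inl t \<Rightarrow> 1 | Inr t \<Rightarrow> 2) + real (case_sum depth depth y) + real (depth s))"

text \<open>
  The ignored saving, halved: the Gram matrix of the sets of ends in the second graph, and zero as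
  soon as one vertex comes from the first graph.
\<close>

definition overlap :: "('a + 'a set) + ('b + 'b set) \<Rightarrow> ('a + 'a set) + ('b + 'b set) \<Rightarrow> real" where
  "overlap x y = (case (x, y) of (Inr s, Inr t) \<Rightarrow> real (card (ends s \<inter> ends t)) | _ \<Rightarrow> 0)"

lemma overlap_simps [simp]:
  "overlap (Inr s) (Inr t) = real (card (ends s \<inter> ends t))"
  "overlap (Inl s) y = 0" "overlap x (Inl t) = 0"
  by (auto simp: overlap_def split: sum.splits)

text \<open>
  The product of the matrices of \<open>overlap\<close> and \<open>flat_dist\<close> when the second graph is \<open>k\<close>-regular.
\<close>

definition overlap_flat :: "nat \<Rightarrow> ('a + 'a set) + ('b + 'b set) \<Rightarrow> ('a + 'a set) + ('b + 'b set) \<Rightarrow> real" where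
  "overlap_flat k x y = (case x of
       Inl _ \<Rightarrow> 0
     | Inr s \<Rightarrow> (1 + real (depth s)) *
         ((1 + real k) * ((case y of Inl t \<Rightarrow> 1 | Inr t \<Rightarrow> 2) + real (case_sum depth depth y)) + real k))"

lemma join_dist_eq_flat_minus_overlap:
  assumes Y: "pair_graph Y" and x: "x \<in> pverts (X \<circledcirc> Y)" and y: "y \<in> pverts (X \<circledcirc> Y)"
  shows "real (join_dist x y) = flat_dist x y - 2 * overlap x y"
  using x y same_side_dist_eq_overlap[OF Y]
  by (cases x; cases y) (auto simp: flat_dist_def)

lemma sum_overlap_join:
  fixes h :: "('a + 'a set) + ('b + 'b set) \<Rightarrow> real"
  assumes X: "pair_graph X" and Y: "pair_graph Y" and reg: "regular_graph k Y"
    and s: "s \<in> pverts (subdivision_graph Y)" and h: "\<And>t. h (Inr t) = g (depth t)"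
  shows "(\<Sum>z\<in>pverts (X \<circledcirc> Y). overlap (Inr s) z * h z) = (1 + real (depth s)) * (g 0 + real k * g 1)"
proof -
  let ?SY = "pverts (subdivision_graph Y)"
  have "(\<Sum>z\<in>pverts (X \<circledcirc> Y). overlap (Inr s) z * h z)
      = (\<Sum>z\<in>Inr ` ?SY. overlap (Inr s) z * h z)"
    using finite_join[OF X Y]
    by (intro sum.mono_neutral_right) (auto simp: subdivision_vv_join_def)
  also have "\<dots> = (\<Sum>t\<in>?SY. real (card (ends s \<inter> ends t)) * g (depth t))"
    by (simp add: sum.reindex h)
  finally show ?thesis
    by (simp add: sum_overlap[OF Y reg s])
qed

lemma overlap_mult_flat_dist:
  assumes X: "pair_graph X" and Y: "pair_graph Y" and reg: "regular_graph k Y"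
    and x: "x \<in> pverts (X \<circledcirc> Y)"
  shows "(\<Sum>z\<in>pverts (X \<circledcirc> Y). overlap x z * flat_dist z y) = overlap_flat k x y"
proof (cases x)
  case (Inr s)
  let ?a = "(case y of Inl t \<Rightarrow> 1 | Inr t \<Rightarrow> 2) + real (case_sum depth depth y)"
  have "(\<Sum>z\<in>pverts (X \<circledcirc> Y). overlap (Inr s) z * flat_dist z y)
      = (1 + real (depth s)) * ((?a + real 0) + real k * (?a + real 1))"
    using Inr x
    by (intro sum_overlap_join[OF X Y reg, where g = "\<lambda>d. ?a + real d"]) (auto simp: flat_dist_def)
  then show ?thesis
    using Inr by (simp add: overlap_flat_def algebra_simps)
qed (simp add: overlap_flat_def)

text \<open>
  The columns of \<open>overlap_flat k\<close> are multiples of the vector \<open>1 + depth\<close> on the second graph. It is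
  an eigenvector of \<open>overlap\<close>, as each end \<open>v\<close> contributes \<open>1\<close> through itself and \<open>2\<close> through each of the
  \<open>k\<close> edges at \<open>v\<close>.
\<close>

lemma overlap_mult_overlap_flat:
  assumes X: "pair_graph X" and Y: "pair_graph Y" and reg: "regular_graph k Y"
    and x: "x \<in> pverts (X \<circledcirc> Y)"
  shows "(\<Sum>z\<in>pverts (X \<circledcirc> Y). overlap x z * overlap_flat k z y) = (1 + 2 * real k) * overlap_flat k x y"
proof (cases x)
  case (Inr s)
  let ?b = "(1 + real k) * ((case y of Inl t \<Rightarrow> 1 | Inr t \<Rightarrow> 2) + real (case_sum depth depth y)) + real k"
  have "(\<Sum>z\<in>pverts (X \<circledcirc> Y). overlap (Inr s) z * overlap_flat k z y)
      = (1 + real (depth s)) * ((1 + real 0) * ?b + real k * ((1 + real 1) * ?b))"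
    using Inr x
    by (intro sum_overlap_join[OF X Y reg, where g = "\<lambda>d. (1 + real d) * ?b"])
      (auto simp: overlap_flat_def)
  also have "\<dots> = (1 + 2 * real k) * ((1 + real (depth s)) * ?b)"
    by (simp add: algebra_simps)
  finally show ?thesis
    using Inr by (simp add: overlap_flat_def)
qed (simp add: overlap_flat_def)

section \<open>Distance energy of joins\<close>

lemma dist_energy_eq_spectral_energy:
  assumes "distinct vs" "set vs = pverts X"
  shows "dist_energy X = spectral_energy (fun_mat vs vs (graph_dist X))"
proof -
  have vl: "distinct (vertex_list X)" "set (vertex_list X) = pverts X"
    using someI[of "\<lambda>vs. distinct vs \<and> set vs = pverts X", OF conjI[OF assms]]
    by (simp_all add: vertex_list_def)
  have "dist_energy X = spectral_energy (fun_mat (vertex_list X) (vertex_list X) (graph_dist X))"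
    by (simp add: Let_def dist_energy_def spectral_energy_def dist_matrix_def fun_mat_def)
  also have "\<dots> = spectral_energy (fun_mat vs vs (graph_dist X))"
    using vl assms by (intro spectral_energy_similar fun_mat_reorder_similar) auto
  finally show ?thesis .
qed

lemma fun_mat_map:
  "fun_mat (map \<phi> us) (map \<psi> vs) f = fun_mat us vs (\<lambda>u v. f (\<phi> u) (\<psi> v))"
  by (intro eq_matI) (auto simp: fun_mat_def)

lemma depth_map_sum [simp]: "depth (map_sum f g s) = depth s"
  by (cases s) auto

lemma flat_dist_map_sum:
  "flat_dist (map_sum id (map_sum f g) x) (map_sum id (map_sum f g) y) = flat_dist x y"
  by (cases x; cases y) (simp_all add: flat_dist_def)

lemma overlap_flat_map_sum:
  "overlap_flat k (map_sum id (map_sum f g) x) (map_sum id (map_sum f g) y) = overlap_flat k x y"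
  by (cases x; cases y) (simp_all add: overlap_flat_def)

lemma join_dist_matrix:
  assumes X: "pair_graph X" and Y: "pair_graph Y" and nonempty: "pverts X \<noteq> {}" "pverts Y \<noteq> {}"
    and vs: "set vs = pverts (X \<circledcirc> Y)"
  shows "fun_mat vs vs (graph_dist (X \<circledcirc> Y)) = fun_mat vs vs flat_dist - 2 \<cdot>\<^sub>m fun_mat vs vs overlap"
proof -
  have "fun_mat vs vs (graph_dist (X \<circledcirc> Y)) = fun_mat vs vs (\<lambda>x y. flat_dist x y - 2 * overlap x y)"
    by (intro fun_mat_cong)
      (simp add: vs graph_dist_join[OF X Y nonempty] join_dist_eq_flat_minus_overlap[OF Y])
  also have "\<dots> = fun_mat vs vs flat_dist - 2 \<cdot>\<^sub>m fun_mat vs vs overlap"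
    by (intro eq_matI) (auto simp: fun_mat_def)
  finally show ?thesis .
qed

lemma join_dist_matrix_symmetric:
  assumes X: "pair_graph X" and Y: "pair_graph Y" and nonempty: "pverts X \<noteq> {}" "pverts Y \<noteq> {}"
    and vs: "set vs = pverts (X \<circledcirc> Y)" and ij: "i < length vs" "j < length vs"
  shows "fun_mat vs vs (graph_dist (X \<circledcirc> Y)) $$ (i, j) = fun_mat vs vs (graph_dist (X \<circledcirc> Y)) $$ (j, i)"
    and "fun_mat vs vs (graph_dist (X \<circledcirc> Y)) $$ (i, i) = 0"
proof -
  have mem: "vs ! i \<in> pverts (X \<circledcirc> Y)" "vs ! j \<in> pverts (X \<circledcirc> Y)"
    using ij vs nth_mem by blast+
  show "fun_mat vs vs (graph_dist (X \<circledcirc> Y)) $$ (i, j) = fun_mat vs vs (graph_dist (X \<circledcirc> Y)) $$ (j, i)"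
    using ij mem by (simp add: fun_mat_def graph_dist_join[OF X Y nonempty] join_dist_commute)
  have "join_dist x x = 0" for x :: "('a + 'a set) + ('b + 'b set)"
    by (cases x) (simp_all add: same_side_dist_eq_0)
  then show "fun_mat vs vs (graph_dist (X \<circledcirc> Y)) $$ (i, i) = 0"
    using ij mem by (simp add: fun_mat_def graph_dist_join[OF X Y nonempty])
qed

lemma overlap_psd:
  assumes Y: "pair_graph Y" and vs: "set vs = pverts (X \<circledcirc> Y)"
  shows "psd_mat (length vs) (fun_mat vs vs overlap)"
proof (rule psd_mat_gram[where C = "pverts Y"])
  fix x y assume xy: "x \<in> set vs" "y \<in> set vs"
  show "overlap x y = (\<Sum>v\<in>pverts Y. (case x of Inl _ \<Rightarrow> 0 | Inr s \<Rightarrow> of_bool (v \<in> ends s))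
      * (case y of Inl _ \<Rightarrow> 0 | Inr t \<Rightarrow> of_bool (v \<in> ends t)))"
    using xy[unfolded vs] overlap_eq_sum[OF Y] by (cases x; cases y) auto
qed

lemma pverts_join_Plus:
  "pverts (X \<circledcirc> Y) = (pverts X <+> graph_edges X) <+> (pverts Y <+> graph_edges Y)"
  by (simp add: subdivision_vv_join_def subdivision_graph_def Plus_def)

lemma bij_betw_map_sum:
  assumes f: "bij_betw f A A'" and g: "bij_betw g B B'"
  shows "bij_betw (map_sum f g) (A <+> B) (A' <+> B')"
proof (rule bij_betw_imageI)
  show "inj_on (map_sum f g) (A <+> B)"
    using bij_betw_imp_inj_on[OF f] bij_betw_imp_inj_on[OF g]
    by (intro inj_onI) (auto dest: inj_onD)
  have "map_sum f g ` (A <+> B) = f ` A <+> g ` B"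
    by (simp add: Plus_def image_Un image_image)
  then show "map_sum f g ` (A <+> B) = A' <+> B'"
    using bij_betw_imp_surj_on[OF f] bij_betw_imp_surj_on[OF g] by simp
qed

text \<open>
  A bijection \<open>\<phi>\<close> that fixes the vertices coming from \<open>X\<close> and preserves depths identifies the two
  vertex sets. Along \<open>\<phi>\<close> the matrices of \<open>flat_dist\<close> and \<open>overlap_flat k\<close> coincide, so the two distance
  matrices differ in their positive semidefinite parts only.
\<close>

lemma dist_energy_join_eq:
  fixes X :: "'a pair_pre_digraph" and Y1 Y2 :: "'b pair_pre_digraph"
  assumes X: "pair_graph X" and Y1: "pair_graph Y1" and Y2: "pair_graph Y2"
    and reg: "regular_graph k Y1" "regular_graph k Y2"
    and card: "card (pverts Y1) = card (pverts Y2)"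
    and nonempty: "pverts X \<noteq> {}" "pverts Y1 \<noteq> {}" "pverts Y2 \<noteq> {}"
  shows "dist_energy (X \<circledcirc> Y1) = dist_energy (X \<circledcirc> Y2)"
proof -
  obtain f where f: "bij_betw f (pverts Y1) (pverts Y2)"
    using finite_same_card_bij[OF finite_pverts[OF Y1] finite_pverts[OF Y2] card] by blast
  have "card (graph_edges Y1) = card (graph_edges Y2)"
    using handshake_regular[OF Y1 reg(1)] handshake_regular[OF Y2 reg(2)] card by simp
  then obtain g where g: "bij_betw g (graph_edges Y1) (graph_edges Y2)"
    using finite_same_card_bij[OF finite_graph_edges[OF Y1] finite_graph_edges[OF Y2]] by blast
  define \<phi> :: "('a + 'a set) + ('b + 'b set) \<Rightarrow> ('a + 'a set) + ('b + 'b set)"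
    where "\<phi> = map_sum id (map_sum f g)"
  have "bij_betw \<phi> (pverts (X \<circledcirc> Y1)) (pverts (X \<circledcirc> Y2))"
    unfolding \<phi>_def pverts_join_Plus using f g by (intro bij_betw_map_sum) simp_all
  then have "inj_on \<phi> (pverts (X \<circledcirc> Y1))" "\<phi> ` pverts (X \<circledcirc> Y1) = pverts (X \<circledcirc> Y2)"
    by (simp_all add: bij_betw_def)
  moreover obtain vs where vs: "distinct vs" "set vs = pverts (X \<circledcirc> Y1)"
    using finite_distinct_list[OF finite_join[OF X Y1]] by auto
  ultimately have ws: "distinct (map \<phi> vs)" "set (map \<phi> vs) = pverts (X \<circledcirc> Y2)"
    by (simp_all add: distinct_map)
  define n where "n = length vs"
  let ?K = "fun_mat vs vs flat_dist :: real mat" and ?F = "fun_mat vs vs (overlap_flat k)"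
  let ?N1 = "fun_mat vs vs overlap" and ?N2 = "fun_mat (map \<phi> vs) (map \<phi> vs) overlap"
  have K: "?K = fun_mat (map \<phi> vs) (map \<phi> vs) flat_dist"
    and F: "?F = fun_mat (map \<phi> vs) (map \<phi> vs) (overlap_flat k)"
    by (simp_all add: fun_mat_map \<phi>_def flat_dist_map_sum overlap_flat_map_sum)
  have mult: "fun_mat us us overlap * fun_mat us us flat_dist = fun_mat us us (overlap_flat k)"
    "fun_mat us us overlap * fun_mat us us (overlap_flat k)
      = (1 + 2 * real k) \<cdot>\<^sub>m fun_mat us us (overlap_flat k)"
    if Y: "pair_graph Y" "regular_graph k Y" and us: "distinct us" "set us = pverts (X \<circledcirc> Y)"
    for Y :: "'b pair_pre_digraph" and us
  proof -
    show "fun_mat us us overlap * fun_mat us us flat_dist = fun_mat us us (overlap_flat k)"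
      unfolding fun_mat_mult[OF us(1)] us(2)
      by (intro fun_mat_cong) (simp add: us(2) overlap_mult_flat_dist[OF X Y])
    have "fun_mat us us overlap * fun_mat us us (overlap_flat k)
        = fun_mat us us (\<lambda>x y. (1 + 2 * real k) * overlap_flat k x y)"
      unfolding fun_mat_mult[OF us(1)] us(2)
      by (intro fun_mat_cong) (simp add: us(2) overlap_mult_overlap_flat[OF X Y])
    also have "\<dots> = (1 + 2 * real k) \<cdot>\<^sub>m fun_mat us us (overlap_flat k)"
      by (intro eq_matI) (auto simp: fun_mat_def)
    finally show "fun_mat us us overlap * fun_mat us us (overlap_flat k)
      = (1 + 2 * real k) \<cdot>\<^sub>m fun_mat us us (overlap_flat k)" .
  qed
  note D1 = join_dist_matrix[OF X Y1 nonempty(1,2) vs(2)]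
  note D2 = join_dist_matrix[OF X Y2 nonempty(1,3) ws(2), folded K]
  have "spectral_energy (?K - 2 \<cdot>\<^sub>m ?N1) = spectral_energy (?K - 2 \<cdot>\<^sub>m ?N2)"
  proof (rule spectral_energy_psd_perturbation[where n = n and F = ?F and c = "1 + 2 * real k"])
    show "psd_mat n ?N1" "psd_mat n ?N2"
      using overlap_psd[OF Y1 vs(2)] overlap_psd[OF Y2 ws(2)] by (simp_all add: n_def)
    show "?N1 * ?K = ?F" "?N1 * ?F = (1 + 2 * real k) \<cdot>\<^sub>m ?F"
      by (rule mult[OF Y1 reg(1) vs])+
    show "?N2 * ?K = ?F" "?N2 * ?F = (1 + 2 * real k) \<cdot>\<^sub>m ?F"
      unfolding K F by (rule mult[OF Y2 reg(2) ws])+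
    fix N i j assume "N \<in> {?N1, ?N2}" and ij: "i < n" "j < n"
    then show "(?K - 2 \<cdot>\<^sub>m N) $$ (i, j) = (?K - 2 \<cdot>\<^sub>m N) $$ (j, i)"
      using join_dist_matrix_symmetric(1)[OF X Y1 nonempty(1,2) vs(2), of i j]
        join_dist_matrix_symmetric(1)[OF X Y2 nonempty(1,3) ws(2), of i j]
      unfolding D1 D2 by (auto simp: n_def)
  next
    fix N i assume "N \<in> {?N1, ?N2}" and i: "i < n"
    then show "(?K - 2 \<cdot>\<^sub>m N) $$ (i, i) = 0"
      using join_dist_matrix_symmetric(2)[OF X Y1 nonempty(1,2) vs(2), of i i]
        join_dist_matrix_symmetric(2)[OF X Y2 nonempty(1,3) ws(2), of i i]
      unfolding D1 D2 by (auto simp: n_def)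
  qed (simp_all add: n_def)
  then show ?thesis
    by (simp only: dist_energy_eq_spectral_energy[OF vs] dist_energy_eq_spectral_energy[OF ws] D1 D2)
qed

lemma card_pverts_join:
  assumes X: "pair_graph X" and Y: "pair_graph Y"
  shows "card (pverts (X \<circledcirc> Y))
    = card (pverts X) + card (graph_edges X) + (card (pverts Y) + card (graph_edges Y))"
  unfolding pverts_join_Plus using X Y by (simp add: card_Plus finite_pverts finite_graph_edges)

theorem D_equienergetic_join:
  fixes X :: "'a pair_pre_digraph" and Y1 Y2 :: "'b pair_pre_digraph"
  assumes X: "pair_graph X" and Y1: "pair_graph Y1" and Y2: "pair_graph Y2"
    and conn: "connected_graph X"
    and reg: "regular_graph k Y1" "regular_graph k Y2"
    and card: "card (pverts Y1) = card (pverts Y2)"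
    and nonempty: "pverts Y1 \<noteq> {}"
  shows "D_equienergetic (X \<circledcirc> Y1) (X \<circledcirc> Y2)"
proof -
  have "pverts X \<noteq> {}"
    using conn by (auto simp: connected_graph_def connected_def strongly_connected_def)
  moreover have "pverts Y2 \<noteq> {}"
    using nonempty card finite_pverts[OF Y1] by auto
  moreover have "card (graph_edges Y1) = card (graph_edges Y2)"
    using handshake_regular[OF Y1 reg(1)] handshake_regular[OF Y2 reg(2)] card by simp
  ultimately show ?thesis
    using dist_energy_join_eq[OF X Y1 Y2 reg card _ nonempty] connected_join[OF X Y1 conn]
      connected_join[OF X Y2 conn] Y1 Y2 card
    by (simp add: D_equienergetic_def card_pverts_join[OF X])
qed

section \<open>Disjoint unions of cycles\<close>

lemma out_degree_with_proj:
  "out_degree (with_proj X) v = card {w. (v, w) \<in> parcs X}"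
proof -
  have "out_arcs (with_proj X) v = Pair v ` {w. (v, w) \<in> parcs X}"
    by auto
  then show ?thesis
    by (simp add: out_degree_def card_image inj_on_def)
qed

lemma pair_graphI:
  assumes "\<And>u v. (u, v) \<in> parcs X \<Longrightarrow> u \<in> pverts X \<and> u \<noteq> v \<and> (v, u) \<in> parcs X"
    and fin: "finite (pverts X)"
  shows "pair_graph X"
proof -
  have "parcs X \<subseteq> pverts X \<times> pverts X"
    by (intro subrelI) (use assms(1) in blast)
  moreover from this have "finite (parcs X)"
    using fin by (meson finite_SigmaI finite_subset)
  ultimately show ?thesis
    by unfold_locales (use assms in \<open>auto simp: symmetric_def intro: symI\<close>)
qed

lemma pair_graph_cycle:
  assumes "3 \<le> p"
  shows "pair_graph (cycle_graph p)"
  by (rule pair_graphI) (use assms in \<open>auto simp: cycle_graph_def mod_Suc split: if_splits\<close>)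

lemma regular_cycle:
  assumes p: "3 \<le> p"
  shows "regular_graph 2 (cycle_graph p)"
  unfolding regular_graph_def out_degree_with_proj
proof
  fix i assume "i \<in> pverts (cycle_graph p)"
  then have i: "i < p"
    by (simp add: cycle_graph_def)
  have "{j. (i, j) \<in> parcs (cycle_graph p)} = {Suc i mod p, if i = 0 then p - 1 else i - 1}"
    using i p by (auto simp: cycle_graph_def mod_Suc split: if_splits)
  also have "card \<dots> = 2"
    using i p by (auto simp: mod_Suc)
  finally show "card {j. (i, j) \<in> parcs (cycle_graph p)} = 2" .
qed

lemma parcs_disjoint_union [simp]:
  "((i, u), (j, v)) \<in> parcs (disjoint_union_graph I F) \<longleftrightarrow> i = j \<and> i \<in> I \<and> (u, v) \<in> parcs (F i)"
  by (auto simp: disjoint_union_graph_def)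

lemma pverts_disjoint_union [simp]:
  "pverts (disjoint_union_graph I F) = Sigma I (\<lambda>i. pverts (F i))"
  by (simp add: disjoint_union_graph_def)

lemma pair_graph_disjoint_union:
  assumes I: "finite I" and F: "\<And>i. i \<in> I \<Longrightarrow> pair_graph (F i)"
  shows "pair_graph (disjoint_union_graph I F)"
proof (rule pair_graphI)
  fix x y assume xy: "(x, y) \<in> parcs (disjoint_union_graph I F)"
  obtain i u j v where [simp]: "x = (i, u)" "y = (j, v)"
    by (cases x; cases y)
  have i: "i \<in> I" "i = j" "(u, v) \<in> parcs (F i)"
    using xy by auto
  interpret pair_graph "F i"
    by (rule F[OF i(1)])
  show "x \<in> pverts (disjoint_union_graph I F) \<and> x \<noteq> y \<and> (y, x) \<in> parcs (disjoint_union_graph I F)"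
    using i in_arcsD1[OF i(3)] pair_no_loops[OF i(3)] pair_sym_arcs
    by (auto simp: symmetric_def dest: symD)
qed (use I F finite_pverts in auto)

lemma regular_disjoint_union:
  assumes "\<And>i. i \<in> I \<Longrightarrow> regular_graph k (F i)"
  shows "regular_graph k (disjoint_union_graph I F)"
  unfolding regular_graph_def out_degree_with_proj
proof
  fix x assume "x \<in> pverts (disjoint_union_graph I F)"
  then obtain i u where x: "x = (i, u)" "i \<in> I" "u \<in> pverts (F i)"
    by auto
  have "{y. (x, y) \<in> parcs (disjoint_union_graph I F)} = Pair i ` {v. (u, v) \<in> parcs (F i)}"
    using x by auto
  then have "card {y. (x, y) \<in> parcs (disjoint_union_graph I F)} = card {v. (u, v) \<in> parcs (F i)}"
    by (simp add: card_image inj_on_def)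
  then show "card {y. (x, y) \<in> parcs (disjoint_union_graph I F)} = k"
    using assms[OF x(2)] x(3) by (simp add: regular_graph_def out_degree_with_proj)
qed

lemma sum_count_mult:
  assumes "finite S" "set_mset P \<subseteq> S"
  shows "(\<Sum>p\<in>S. count P p * p) = sum_mset P"
  using assms(2)
proof (induct P)
  case (add q P)
  have "(\<Sum>p\<in>S. count (add_mset q P) p * p)
      = (\<Sum>p\<in>S. (if q = p then p else 0) + count P p * p)"
    by (rule sum.cong) auto
  then show ?case
    using add assms(1) by (simp add: sum.distrib)
qed simp

lemma part_occurrences: "{(p, k). k < count P p} = (SIGMA p:set_mset P. {..<count P p})"
  by (auto simp flip: count_greater_zero_iff)

lemma cycles_graph_of_partition:
  assumes P: "P \<in> partitions_ge3 l"
  shows pair_graph_cycles: "pair_graph (cycles_graph P)"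
    and regular_cycles: "regular_graph 2 (cycles_graph P)"
    and card_cycles: "card (pverts (cycles_graph P)) = l"
proof -
  have ge3: "3 \<le> p" if "k < count P p" for p k
  proof -
    have "p \<in># P"
      using that by (simp flip: count_greater_zero_iff)
    then show ?thesis
      using P by (simp add: partitions_ge3_def)
  qed
  have fin: "finite {(p, k). k < count P p}"
    by (simp add: part_occurrences)
  show "pair_graph (cycles_graph P)"
    unfolding cycles_graph_def
    by (rule pair_graph_disjoint_union[OF fin]) (auto intro: pair_graph_cycle ge3)
  show "regular_graph 2 (cycles_graph P)"
    unfolding cycles_graph_def
    by (rule regular_disjoint_union) (auto intro: regular_cycle ge3)
  have "card (pverts (cycles_graph P)) = (\<Sum>(p, k)\<in>{(p, k). k < count P p}. p)"
    unfolding cycles_graph_def pverts_disjoint_union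
    by (subst card_SigmaI[OF fin]) (auto simp: cycle_graph_def intro!: sum.cong)
  also have "\<dots> = (\<Sum>p\<in>set_mset P. count P p * p)"
    unfolding part_occurrences by (subst sum.Sigma[symmetric]) auto
  also have "\<dots> = l"
    using P sum_count_mult[of "set_mset P" P] by (simp add: partitions_ge3_def)
  finally show "card (pverts (cycles_graph P)) = l" .
qed

text \<open>
  For \<open>l = 0\<close> the only partition is the empty one and there is no vertex to cross over to; for
  \<open>l > 0\<close> every \<open>C\<^sub>P\<close> is a nonempty 2-regular graph on \<open>l\<close> vertices.
\<close>

theorem theorem4p4:
  fixes G :: "'a pair_pre_digraph" and r n m l :: nat
  assumes "pair_graph G"
    and "connected_graph G"
    and "regular_graph r G"
    and "card (pverts G) = n"
    and "card (graph_edges G) = m"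
  shows "\<forall>P \<in> partitions_ge3 l. \<forall>Q \<in> partitions_ge3 l.
           D_equienergetic (G \<circledcirc> cycles_graph P) (G \<circledcirc> cycles_graph Q)"
proof (intro ballI)
  fix P Q assume P: "P \<in> partitions_ge3 l" and Q: "Q \<in> partitions_ge3 l"
  note P' = cycles_graph_of_partition[OF P] and Q' = cycles_graph_of_partition[OF Q]
  show "D_equienergetic (G \<circledcirc> cycles_graph P) (G \<circledcirc> cycles_graph Q)"
  proof (cases "l = 0")
    case True
    have "P = Q"
      using P Q True by (auto simp: partitions_ge3_def) (metis not_numeral_le_zero multiset_nonemptyE)+
    then show ?thesis
      using connected_join[OF assms(1) P'(1) assms(2)] by (simp add: D_equienergetic_def)
  next
    case False
    then have "pverts (cycles_graph P) \<noteq> {}"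
      using P'(3) by auto
    then show ?thesis
      using D_equienergetic_join[OF assms(1) P'(1) Q'(1) assms(2) P'(2) Q'(2)] P'(3) Q'(3) by simp
  qed
qed

end
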